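(* There exists a finite generating set $S$ of the free group $F_2 = \langle a,b\rangle$ of rank 2 (closed under inversion and not containing the identity) such that, with respect to $S$, $F_2$ has zero curvature with positive density and also negative curvature with positive density. That is, there exist $\epsilon>0$ and an integer $N\geq 0$ such that for all $n\geq N$ $$\frac{|\{g\in B_n\setminus\{1\} : \kappa(g)=0\}|}{|B_n|}\geq \epsilon,$$ and there exist $\epsilon'>0$ and an integer $N'\geq 0$ such that for all $n\geq N'$ $$\frac{|\{g\in B_n\setminus\{1\} : \kappa(g)<0\}|}{|B_n|}\geq \epsilon'.$$
   Context: For a group $G$ with finite generating set $S$ (closed under inversion, not containing the identity), $|g|$ is the word length of $g$ with respect to $S$, i.e. the minimal $n$ such that $g=g_1\cdots g_n$ with all $g_i\in S$. $B_n=\{g\in G : |g|\leq n\}$. For $g\neq 1$, the (1-spherical) conjugation curvature is $$\kappa(g)=\frac{|g|-\mathrm{GenCon}(g)}{|g|},\qquad \mathrm{GenCon}(g)=\frac{1}{|S|}\sum_{s\in S}|s^{-1}gs|.$$ *)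

theory Defs
  imports "HOL-Algebra.Generated_Groups" Complex_Main
begin

definition sym_generating_set :: "('g, 'm) monoid_scheme \<Rightarrow> 'g set \<Rightarrow> bool" where
  "sym_generating_set G S \<longleftrightarrow>
     finite S \<and> S \<subseteq> carrier G \<and> generate G S = carrier G \<and>
     (\<forall>s\<in>S. inv\<^bsub>G\<^esub> s \<in> S) \<and> \<one>\<^bsub>G\<^esub> \<notin> S"

text \<open>The empty product is allowed, so the identity has length 0.  For elements outside the
  submonoid generated by \<open>S\<close> the value is unspecified; there are none if
  \<open>sym_generating_set G S\<close> holds.\<close>

definition word_length :: "('g, 'm) monoid_scheme \<Rightarrow> 'g set \<Rightarrow> 'g \<Rightarrow> nat" where
  "word_length G S g =
     (LEAST n. \<exists>ws. length ws = n \<and> set ws \<subseteq> S \<and> foldr (\<otimes>\<^bsub>G\<^esub>) ws \<one>\<^bsub>G\<^esub> = g)"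

definition word_ball :: "('g, 'm) monoid_scheme \<Rightarrow> 'g set \<Rightarrow> nat \<Rightarrow> 'g set" where
  "word_ball G S n = {g \<in> carrier G. word_length G S g \<le> n}"

definition gen_con :: "('g, 'm) monoid_scheme \<Rightarrow> 'g set \<Rightarrow> 'g \<Rightarrow> real" where
  "gen_con G S g =
     (1 / real (card S)) *
     (\<Sum>s\<in>S. real (word_length G S (inv\<^bsub>G\<^esub> s \<otimes>\<^bsub>G\<^esub> g \<otimes>\<^bsub>G\<^esub> s)))"

definition curvature :: "('g, 'm) monoid_scheme \<Rightarrow> 'g set \<Rightarrow> 'g \<Rightarrow> real" where
  "curvature G S g =
     (real (word_length G S g) - gen_con G S g) / real (word_length G S g)"

text \<open>The identity is excluded: mathematically its curvature is undefined, here it is 0.\<close>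

definition curvature_positive_density ::
    "('g, 'm) monoid_scheme \<Rightarrow> 'g set \<Rightarrow> (real \<Rightarrow> bool) \<Rightarrow> bool" where
  "curvature_positive_density G S P \<longleftrightarrow>
     (\<exists>\<epsilon>>0. \<exists>N. \<forall>n\<ge>N.
        real (card {g \<in> word_ball G S n - {\<one>\<^bsub>G\<^esub>}. P (curvature G S g)})
          / real (card (word_ball G S n)) \<ge> (\<epsilon> :: real))"

text \<open>The free group on \<open>X\<close> consists of the reduced words in the letters \<open>(True, x)\<close>,
  standing for \<open>x\<close>, and \<open>(False, x)\<close>, standing for the inverse of \<open>x\<close>.\<close>

type_synonym 'a word = "(bool \<times> 'a) list"

definition letter_inv :: "bool \<times> 'a \<Rightarrow> bool \<times> 'a" where
  "letter_inv l = (\<not> fst l, snd l)"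

fun reduced :: "'a word \<Rightarrow> bool" where
  "reduced [] \<longleftrightarrow> True"
| "reduced [l] \<longleftrightarrow> True"
| "reduced (k # l # w) \<longleftrightarrow> k \<noteq> letter_inv l \<and> reduced (l # w)"

text \<open>Left multiplication of a reduced word by a letter, with cancellation.\<close>

fun cons_reduce :: "bool \<times> 'a \<Rightarrow> 'a word \<Rightarrow> 'a word" where
  "cons_reduce k [] = [k]"
| "cons_reduce k (l # w) = (if k = letter_inv l then w else k # l # w)"

definition free_group :: "'a set \<Rightarrow> 'a word monoid" where
  "free_group X =
     \<lparr>carrier = {w. reduced w \<and> snd ` set w \<subseteq> X},
      mult = (\<lambda>u v. foldr cons_reduce u v),
      one = []\<rparr>"

datatype gen2 = Gen_a | Gen_b

definition F2 :: "gen2 word monoid" where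
  "F2 = free_group UNIV"

text \<open>\<open>free_group X\<close> is a group, generated by \<open>X\<close>, with the universal property
  of a free group.\<close>

lemma letter_inv_letter_inv [simp]: "letter_inv (letter_inv l) = l"
  by (simp add: letter_inv_def)

lemma letter_inv_neq [simp]: "letter_inv l \<noteq> l" "l \<noteq> letter_inv l"
  by (simp_all add: letter_inv_def prod_eq_iff)

lemma snd_letter_inv [simp]: "snd (letter_inv l) = snd l"
  by (simp add: letter_inv_def)

lemma reduced_ConsD: "reduced (l # w) \<Longrightarrow> reduced w"
  by (cases w) auto

lemma reduced_cons_reduce: "reduced w \<Longrightarrow> reduced (cons_reduce l w)"
  by (cases w) (auto dest: reduced_ConsD)

lemma cons_reduce_reduced: "reduced (l # w) \<Longrightarrow> cons_reduce l w = l # w"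
  by (cases w) auto

lemma cons_reduce_inverse: "reduced w \<Longrightarrow> cons_reduce (letter_inv l) (cons_reduce l w) = w"
  by (cases w) (auto simp: cons_reduce_reduced)

lemma cons_reduce_inverse': "reduced w \<Longrightarrow> cons_reduce l (cons_reduce (letter_inv l) w) = w"
  using cons_reduce_inverse[of w "letter_inv l"] by simp

lemma reduced_foldr: "reduced v \<Longrightarrow> reduced (foldr cons_reduce u v)"
  by (induction u) (auto intro: reduced_cons_reduce)

lemma set_cons_reduce: "snd ` set (cons_reduce l w) \<subseteq> insert (snd l) (snd ` set w)"
  by (cases w) auto

lemma set_foldr_cons_reduce:
  "snd ` set (foldr cons_reduce u v) \<subseteq> snd ` set u \<union> snd ` set v"
proof (induction u)
  case (Cons l u)
  then show ?case
    using set_cons_reduce[of l "foldr cons_reduce u v"]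
    by (simp del: image_subset_iff) blast
qed simp

lemma foldr_cons_reduce_cons_reduce:
  assumes "reduced v"
  shows "foldr cons_reduce (cons_reduce l u) v = cons_reduce l (foldr cons_reduce u v)"
proof (cases u)
  case (Cons k u')
  then show ?thesis
    using assms by (auto simp: cons_reduce_inverse reduced_foldr)
qed simp

lemma foldr_cons_reduce_assoc:
  assumes "reduced w"
  shows "foldr cons_reduce (foldr cons_reduce u v) w =
         foldr cons_reduce u (foldr cons_reduce v w)"
  by (induction u) (simp_all add: foldr_cons_reduce_cons_reduce assms)

lemma foldr_cons_reduce_Nil: "reduced w \<Longrightarrow> foldr cons_reduce w [] = w"
proof (induction w)
  case (Cons l w)
  then show ?case
    using reduced_ConsD[of l w] cons_reduce_reduced[of l w] by simp
qed simp

lemma foldr_cons_reduce_left_inv: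
  "reduced v \<Longrightarrow> foldr cons_reduce (rev (map letter_inv w)) (foldr cons_reduce w v) = v"
  by (induction w arbitrary: v) (auto simp: cons_reduce_inverse reduced_foldr)

lemma group_free_group: "group (free_group X)"
proof (rule groupI)
  fix u assume u: "u \<in> carrier (free_group X)"
  let ?u' = "foldr cons_reduce (rev (map letter_inv u)) []"
  have "?u' \<in> carrier (free_group X)"
    using u set_foldr_cons_reduce[of "rev (map letter_inv u)" "[]"]
    by (auto simp: free_group_def reduced_foldr image_image)
  moreover have "foldr cons_reduce ?u' u = []"
  proof -
    have "foldr cons_reduce ?u' u = foldr cons_reduce (rev (map letter_inv u)) u"
      using u foldr_cons_reduce_assoc[of u "rev (map letter_inv u)" "[]"]
      by (simp add: free_group_def)
    also have "\<dots> = []"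
      using foldr_cons_reduce_left_inv[of "[]" u] u
      by (simp add: free_group_def foldr_cons_reduce_Nil)
    finally show ?thesis .
  qed
  ultimately show "\<exists>v\<in>carrier (free_group X). v \<otimes>\<^bsub>free_group X\<^esub> u = \<one>\<^bsub>free_group X\<^esub>"
    by (auto simp: free_group_def)
next
  fix u v assume "u \<in> carrier (free_group X)" "v \<in> carrier (free_group X)"
  then show "u \<otimes>\<^bsub>free_group X\<^esub> v \<in> carrier (free_group X)"
    using subset_trans[OF set_foldr_cons_reduce[of u v], of X]
    by (simp add: free_group_def reduced_foldr del: image_subset_iff)
qed (auto simp: free_group_def foldr_cons_reduce_assoc)

lemma inv_free_group_letter:
  assumes "x \<in> X"
  shows "inv\<^bsub>free_group X\<^esub> [(True, x)] = [(False, x)]"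
  using assms
  by (intro group.inv_equality[OF group_free_group]) (auto simp: free_group_def letter_inv_def)

lemma generate_free_group:
  "generate (free_group X) ((\<lambda>x. [(True, x)]) ` X) = carrier (free_group X)"
proof
  show "generate (free_group X) ((\<lambda>x. [(True, x)]) ` X) \<subseteq> carrier (free_group X)"
    by (intro group.generate_incl[OF group_free_group]) (auto simp: free_group_def)
next
  have "reduced w \<Longrightarrow> snd ` set w \<subseteq> X \<Longrightarrow>
        w \<in> generate (free_group X) ((\<lambda>x. [(True, x)]) ` X)" for w
  proof (induction w)
    case Nil
    then show ?case
      using generate.one[of "free_group X"] by (simp add: free_group_def)
  next
    case (Cons l w)
    obtain e x where l: "l = (e, x)" by (cases l)
    with Cons.prems have x: "x \<in> X" by auto
    have "[l] \<in> generate (free_group X) ((\<lambda>x. [(True, x)]) ` X)"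
    proof (cases e)
      case True
      then show ?thesis using l x by (auto intro: generate.incl)
    next
      case False
      then show ?thesis
        using l x generate.inv[of "[(True, x)]" "(\<lambda>x. [(True, x)]) ` X" "free_group X"]
        by (auto simp: inv_free_group_letter)
    qed
    moreover have "w \<in> generate (free_group X) ((\<lambda>x. [(True, x)]) ` X)"
      using Cons by (auto dest: reduced_ConsD)
    ultimately have "[l] \<otimes>\<^bsub>free_group X\<^esub> w \<in> generate (free_group X) ((\<lambda>x. [(True, x)]) ` X)"
      by (rule generate.eng)
    then show ?case
      using Cons.prems by (simp add: free_group_def cons_reduce_reduced)
  qed
  then show "carrier (free_group X) \<subseteq> generate (free_group X) ((\<lambda>x. [(True, x)]) ` X)"
    by (auto simp: free_group_def)
qed

lemma free_group_universal:
  assumes "group G" and f: "f \<in> X \<rightarrow> carrier G"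
  shows "\<exists>h\<in>hom (free_group X) G. \<forall>x\<in>X. h [(True, x)] = f x"
proof -
  interpret G: group G by fact
  define lt where "lt = (\<lambda>l. if fst l then f (snd l) else inv\<^bsub>G\<^esub> (f (snd l)))"
  define h where "h = (\<lambda>w. foldr (\<lambda>l g. lt l \<otimes>\<^bsub>G\<^esub> g) w \<one>\<^bsub>G\<^esub>)"
  have lt: "lt l \<in> carrier G" if "snd l \<in> X" for l
    using f that by (auto simp: lt_def)
  have lt_inv: "lt (letter_inv l) = inv\<^bsub>G\<^esub> (lt l)" if "snd l \<in> X" for l
    using f that by (auto simp: lt_def letter_inv_def dest: funcset_mem)
  have h_closed: "h w \<in> carrier G" if "snd ` set w \<subseteq> X" for w
    using that by (induction w) (auto simp: h_def lt)
  have h_cons: "h (cons_reduce l w) = lt l \<otimes>\<^bsub>G\<^esub> h w"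
    if "snd l \<in> X" "snd ` set w \<subseteq> X" for l w
  proof (cases w)
    case Nil
    then show ?thesis by (simp add: h_def)
  next
    case (Cons k w')
    then have k: "snd k \<in> X" and w': "h w' \<in> carrier G"
      using that h_closed[of w'] by auto
    have hw: "h w = lt k \<otimes>\<^bsub>G\<^esub> h w'"
      using Cons by (simp add: h_def)
    show ?thesis
    proof (cases "l = letter_inv k")
      case True
      then show ?thesis
        using Cons hw k w' lt lt_inv by (simp add: G.m_assoc[symmetric])
    next
      case False
      then show ?thesis
        using Cons by (simp add: h_def)
    qed
  qed
  have h_mult: "h (foldr cons_reduce u v) = h u \<otimes>\<^bsub>G\<^esub> h v"
    if "snd ` set u \<subseteq> X" "snd ` set v \<subseteq> X" for u v
    using that(1)
  proof (induction u)
    case Nil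
    then show ?case using h_closed[OF that(2)] by (simp add: h_def)
  next
    case (Cons l u)
    have "h (foldr cons_reduce (l # u) v) = lt l \<otimes>\<^bsub>G\<^esub> h (foldr cons_reduce u v)"
      using h_cons[of l "foldr cons_reduce u v"] Cons.prems that(2)
        subset_trans[OF set_foldr_cons_reduce[of u v], of X]
      by (simp del: image_subset_iff)
    also have "\<dots> = lt l \<otimes>\<^bsub>G\<^esub> h u \<otimes>\<^bsub>G\<^esub> h v"
      using Cons lt[of l] h_closed[of u] h_closed[OF that(2)] by (simp add: G.m_assoc)
    also have "lt l \<otimes>\<^bsub>G\<^esub> h u = h (l # u)"
      by (simp add: h_def)
    finally show ?case .
  qed
  have "h \<in> hom (free_group X) G"
    by (rule homI) (auto simp: free_group_def intro: h_closed h_mult)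
  moreover have "h [(True, x)] = f x" if "x \<in> X" for x
    using that f by (auto simp: h_def lt_def dest: funcset_mem)
  ultimately show ?thesis by blast
qed

end

theory Submission imports Defs begin

text \<open>Take \<open>S = {a\<^sup>\<plusminus>\<^sup>2, a\<^sup>\<plusminus>\<^sup>3, b\<^sup>\<plusminus>\<^sup>1}\<close>.  As \<open>F\<^sub>2\<close> is the free product of
  \<open>\<langle>a\<rangle>\<close> and \<open>\<langle>b\<rangle>\<close>, the length of an element is the sum of the lengths of its syllables.  With respect
  to \<open>{\<plusminus>2, \<plusminus>3}\<close> the integer 1 has length 2, and its four neighbours \<open>-2, -1, 3, 4\<close> have total length
  6 instead of 8.  So at each end of \<open>g = a b\<^sup>\<plusminus>\<^sup>1 \<cdots> b\<^sup>\<plusminus>\<^sup>1 a\<close> the gain 2 from conjugation by powers of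
  \<open>a\<close> cancels the loss 2 from conjugation by \<open>b\<^sup>\<plusminus>\<^sup>1\<close>, and \<open>\<kappa>(g) = 0\<close>.  For
  \<open>g = b a\<^sup>\<plusminus>\<^sup>1 \<cdots> a\<^sup>\<plusminus>\<^sup>1 b\<close> conjugation by \<open>b\<^sup>\<plusminus>\<^sup>1\<close> preserves the length and conjugation by
  powers of \<open>a\<close> increases it, so \<open>\<kappa>(g) < 0\<close>.  Both shapes have positive density because every \<open>h\<close>
  of length at most \<open>n - 6\<close> can be completed to such a \<open>g\<close> of length at most \<open>n\<close>.\<close>

section \<open>Word length\<close>

lemma word_length_le:
  "set ws \<subseteq> S \<Longrightarrow> word_length G S (foldr (\<otimes>\<^bsub>G\<^esub>) ws \<one>\<^bsub>G\<^esub>) \<le> length ws"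
  unfolding word_length_def by (rule Least_le) blast

context group
begin

lemma foldr_mult_closed:
  "set ws \<subseteq> carrier G \<Longrightarrow> foldr (\<otimes>) ws \<one> \<in> carrier G"
  by (induction ws) auto

lemma foldr_mult_append:
  "set us \<subseteq> carrier G \<Longrightarrow> set vs \<subseteq> carrier G \<Longrightarrow>
     foldr (\<otimes>) (us @ vs) \<one> = foldr (\<otimes>) us \<one> \<otimes> foldr (\<otimes>) vs \<one>"
  by (induction us) (auto simp: foldr_mult_closed m_assoc)

text \<open>\<open>generate\<close> also admits inverses of generators; closure of \<open>S\<close>
  under inversion turns them into letters.\<close>

lemma ex_word_of_generate:
  assumes "S \<subseteq> carrier G" "\<forall>s\<in>S. inv s \<in> S" "g \<in> generate G S"
  shows "\<exists>ws. set ws \<subseteq> S \<and> foldr (\<otimes>) ws \<one> = g"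
  using assms(3)
proof (induction rule: generate.induct)
  case one
  show ?case by (rule exI[of _ "[]"]) simp
next
  case (incl h)
  then show ?case using assms by (intro exI[of _ "[h]"]) auto
next
  case (inv h)
  then show ?case using assms by (intro exI[of _ "[inv h]"]) auto
next
  case (eng g h)
  then obtain us vs where
    "set us \<subseteq> S" "foldr (\<otimes>) us \<one> = g" "set vs \<subseteq> S" "foldr (\<otimes>) vs \<one> = h" by blast
  then show ?case using foldr_mult_append[of us vs] assms(1)
    by (intro exI[of _ "us @ vs"]) auto
qed

lemma word_length_witness:
  assumes "sym_generating_set G S" "g \<in> carrier G"
  obtains ws where "set ws \<subseteq> S" "foldr (\<otimes>) ws \<one> = g" "length ws = word_length G S g"
proof -
  have "\<exists>n ws. length ws = n \<and> set ws \<subseteq> S \<and> foldr (\<otimes>) ws \<one> = g"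
    using ex_word_of_generate[of S g] assms by (auto simp: sym_generating_set_def)
  from LeastI_ex[OF this] show thesis
    using that unfolding word_length_def by blast
qed

lemma word_length_mult_le:
  assumes S: "sym_generating_set G S" and "g \<in> carrier G" "h \<in> carrier G"
  shows "word_length G S (g \<otimes> h) \<le> word_length G S g + word_length G S h"
proof -
  obtain us vs where us: "set us \<subseteq> S" "foldr (\<otimes>) us \<one> = g" "length us = word_length G S g"
    and vs: "set vs \<subseteq> S" "foldr (\<otimes>) vs \<one> = h" "length vs = word_length G S h"
    using word_length_witness[OF S] assms(2,3) by metis
  have "S \<subseteq> carrier G" using S by (simp add: sym_generating_set_def)
  then have "foldr (\<otimes>) (us @ vs) \<one> = g \<otimes> h"
    using foldr_mult_append[of us vs] us(1,2) vs(1,2) by blast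
  then show ?thesis
    using word_length_le[of "us @ vs" S G] us vs by simp
qed

text \<open>Each letter raises \<open>f\<close> by at most 1, so no word for an element is shorter
  than its \<open>f\<close>-value; \<open>ws\<close> attains this bound.\<close>

lemma word_length_eqI:
  assumes "S \<subseteq> carrier G"
    and "f \<one> = 0"
    and step: "\<And>s g. s \<in> S \<Longrightarrow> g \<in> carrier G \<Longrightarrow> f (s \<otimes> g) \<le> Suc (f g)"
    and ws: "set ws \<subseteq> S" "length ws = f (foldr (\<otimes>) ws \<one>)"
  shows "word_length G S (foldr (\<otimes>) ws \<one>) = f (foldr (\<otimes>) ws \<one>)"
proof -
  have lower: "f (foldr (\<otimes>) us \<one>) \<le> length us" if "set us \<subseteq> S" for us
    using that
  proof (induction us)
    case (Cons s us)
    then have "foldr (\<otimes>) us \<one> \<in> carrier G"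
      using assms(1) by (intro foldr_mult_closed) auto
    then show ?case using Cons step[of s "foldr (\<otimes>) us \<one>"] by simp
  qed (simp add: assms(2))
  show ?thesis
    unfolding word_length_def
  proof (rule Least_equality)
    show "\<exists>us. length us = f (foldr (\<otimes>) ws \<one>) \<and> set us \<subseteq> S \<and> foldr (\<otimes>) us \<one> = foldr (\<otimes>) ws \<one>"
      using ws by blast
  next
    fix n assume "\<exists>us. length us = n \<and> set us \<subseteq> S \<and> foldr (\<otimes>) us \<one> = foldr (\<otimes>) ws \<one>"
    then show "f (foldr (\<otimes>) ws \<one>) \<le> n" using lower by metis
  qed
qed

section \<open>Growth of balls and a criterion for positive density\<close>

lemma word_ball_Suc_subset:
  assumes S: "sym_generating_set G S"
  shows "word_ball G S (Suc n) \<subseteq> word_ball G S n \<union> (\<lambda>(s, g). s \<otimes> g) ` (S \<times> word_ball G S n)"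
proof
  fix g assume g: "g \<in> word_ball G S (Suc n)"
  then have "g \<in> carrier G" "word_length G S g \<le> Suc n" by (simp_all add: word_ball_def)
  then obtain ws where ws: "set ws \<subseteq> S" "foldr (\<otimes>) ws \<one> = g" "length ws \<le> Suc n"
    using word_length_witness[OF S, of g] by metis
  have sub: "S \<subseteq> carrier G" using S by (simp add: sym_generating_set_def)
  show "g \<in> word_ball G S n \<union> (\<lambda>(s, g). s \<otimes> g) ` (S \<times> word_ball G S n)"
  proof (cases ws)
    case Nil
    then have "g = \<one>" using ws(2) by simp
    then show ?thesis using word_length_le[of "[]" S G] by (simp add: word_ball_def)
  next
    case (Cons s us)
    have "foldr (\<otimes>) us \<one> \<in> word_ball G S n"
      unfolding word_ball_def
    proof (rule CollectI, rule conjI)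
      show "foldr (\<otimes>) us \<one> \<in> carrier G"
        using ws(1) Cons sub by (intro foldr_mult_closed) auto
      have "set us \<subseteq> S" "length us \<le> n" using ws Cons by auto
      then show "word_length G S (foldr (\<otimes>) us \<one>) \<le> n"
        using word_length_le[of us S G] by (rule_tac le_trans)
    qed
    moreover have "s \<in> S" "g = s \<otimes> foldr (\<otimes>) us \<one>" using ws Cons by auto
    ultimately show ?thesis by blast
  qed
qed

text \<open>The ball of radius \<open>n + 1\<close> is covered by the ball of radius
  \<open>n\<close> and its \<open>card S\<close> left translates. A bounded change of radius thus
  costs only a bounded factor.\<close>

lemma word_ball_growth:
  assumes S: "sym_generating_set G S"
  shows "finite (word_ball G S n) \<and> card (word_ball G S (n + k)) \<le> (card S + 1) ^ k * card (word_ball G S n)"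
proof -
  have fS: "finite S" using S by (simp add: sym_generating_set_def)
  have fin: "finite (word_ball G S n)" for n
  proof (induction n)
    case 0
    have "g = \<one>" if "g \<in> word_ball G S 0" for g
    proof -
      have "g \<in> carrier G" "word_length G S g = 0" using that by (simp_all add: word_ball_def)
      then obtain ws where "foldr (\<otimes>) ws \<one> = g" "ws = []"
        using word_length_witness[OF S, of g] by (metis length_0_conv)
      then show ?thesis by simp
    qed
    then have "word_ball G S 0 \<subseteq> {\<one>}" by blast
    then show ?case by (rule finite_subset) simp
  next
    case (Suc n)
    then show ?case by (intro finite_subset[OF word_ball_Suc_subset[OF S]]) (use fS in auto)
  qed
  have step: "card (word_ball G S (Suc n)) \<le> (card S + 1) * card (word_ball G S n)" for n
  proof -
    let ?B = "word_ball G S n"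
    have "card (word_ball G S (Suc n)) \<le> card (?B \<union> (\<lambda>(s, g). s \<otimes> g) ` (S \<times> ?B))"
      using fin fS by (intro card_mono word_ball_Suc_subset S) auto
    also have "\<dots> \<le> card ?B + card ((\<lambda>(s, g). s \<otimes> g) ` (S \<times> ?B))"
      by (rule card_Un_le)
    also have "\<dots> \<le> card ?B + card (S \<times> ?B)"
      using fin fS by (intro add_left_mono card_image_le) auto
    also have "\<dots> = (card S + 1) * card ?B"
      by (simp add: card_cartesian_product)
    finally show ?thesis .
  qed
  have "card (word_ball G S (n + k)) \<le> (card S + 1) ^ k * card (word_ball G S n)"
  proof (induction k)
    case (Suc k)
    have "card (word_ball G S (n + Suc k)) \<le> (card S + 1) * card (word_ball G S (n + k))"
      using step[of "n + k"] by simp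
    also have "\<dots> \<le> (card S + 1) * ((card S + 1) ^ k * card (word_ball G S n))"
      by (intro mult_left_mono Suc) simp
    finally show ?case by (simp only: power_Suc mult.assoc)
  qed simp
  with fin show ?thesis by blast
qed

text \<open>For \<open>n \<ge> k\<close>, \<open>\<phi>\<close> embeds the ball of radius
  \<open>n - k\<close> into the good part of the ball of radius \<open>n\<close>, and by ball growth
  the smaller ball is at least a fixed fraction of the larger one.\<close>

lemma curvature_positive_densityI:
  assumes S: "sym_generating_set G S"
    and inj: "inj_on \<phi> (carrier G)"
    and \<phi>: "\<And>h. h \<in> carrier G \<Longrightarrow> \<phi> h \<in> carrier G - {\<one>} \<and> P (curvature G S (\<phi> h)) \<and>
              word_length G S (\<phi> h) \<le> word_length G S h + k"
  shows "curvature_positive_density G S P"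
proof -
  define c where "c = real ((card S + 1) ^ k)"
  have c: "c > 0" by (simp add: c_def)
  have "1 / c \<le> real (card {g \<in> word_ball G S n - {\<one>}. P (curvature G S g)}) / real (card (word_ball G S n))"
    if "n \<ge> k" for n
  proof -
    let ?A = "{g \<in> word_ball G S n - {\<one>}. P (curvature G S g)}"
    have fin: "finite (word_ball G S n)" using word_ball_growth[OF S] by blast
    have "\<phi> ` word_ball G S (n - k) \<subseteq> ?A"
      using \<phi> that by (fastforce simp: word_ball_def)
    then have "card (\<phi> ` word_ball G S (n - k)) \<le> card ?A"
      using fin by (intro card_mono) auto
    moreover have "inj_on \<phi> (word_ball G S (n - k))"
      by (rule inj_on_subset[OF inj]) (auto simp: word_ball_def)
    ultimately have 1: "card (word_ball G S (n - k)) \<le> card ?A"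
      by (simp add: card_image)
    have "card (word_ball G S n) \<le> (card S + 1) ^ k * card (word_ball G S (n - k))"
      using word_ball_growth[OF S, of "n - k" k] that by simp
    also have "\<dots> \<le> (card S + 1) ^ k * card ?A"
      using 1 by simp
    finally have "real (card (word_ball G S n)) \<le> real ((card S + 1) ^ k * card ?A)"
      by (rule of_nat_mono)
    then have 2: "real (card (word_ball G S n)) \<le> c * real (card ?A)"
      by (simp only: c_def of_nat_mult)
    have "\<one> \<in> word_ball G S n"
      using word_length_le[of "[]" S G] by (simp add: word_ball_def)
    then have "card (word_ball G S n) > 0" using fin by (auto simp: card_gt_0_iff)
    then show ?thesis using 2 c by (simp add: field_simps)
  qed
  then show ?thesis
    unfolding curvature_positive_density_def
    using c by (intro exI[of _ "1 / c"] conjI exI[of _ k]) auto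
qed

end

section \<open>The generating set\<close>

abbreviation a where "a \<equiv> (True, Gen_a)"
abbreviation a' where "a' \<equiv> (False, Gen_a)"
abbreviation b where "b \<equiv> (True, Gen_b)"
abbreviation b' where "b' \<equiv> (False, Gen_b)"

definition S23 :: "gen2 word set" where
  "S23 = {[a,a], [a',a'], [a,a,a], [a',a',a'], [b], [b']}"

interpretation F2: group F2
  unfolding F2_def by (rule group_free_group)

lemma carrier_F2 [simp]: "carrier F2 = {w. reduced w}"
  and mult_F2 [simp]: "(\<otimes>\<^bsub>F2\<^esub>) = foldr cons_reduce"
  and one_F2 [simp]: "\<one>\<^bsub>F2\<^esub> = []"
  by (simp_all add: F2_def free_group_def)

lemma inv_F2_S23:
  "inv\<^bsub>F2\<^esub> [a,a] = [a',a']" "inv\<^bsub>F2\<^esub> [a',a'] = [a,a]"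
  "inv\<^bsub>F2\<^esub> [a,a,a] = [a',a',a']" "inv\<^bsub>F2\<^esub> [a',a',a'] = [a,a,a]"
  "inv\<^bsub>F2\<^esub> [b] = [b']" "inv\<^bsub>F2\<^esub> [b'] = [b]"
  by (rule F2.inv_equality; simp add: letter_inv_def)+

lemma sym_generating_set_S23: "sym_generating_set F2 S23"
proof -
  have S: "S23 \<subseteq> carrier F2" by (auto simp: S23_def letter_inv_def)
  have sub: "subgroup (generate F2 S23) F2"
    using S by (rule F2.generate_is_subgroup)
  \<comment> \<open>The exponents 2 and 3 are coprime: 3 - 2 = 1.\<close>
  have "[a,a,a] \<otimes>\<^bsub>F2\<^esub> [a',a'] \<in> generate F2 S23"
    by (intro generate.eng generate.incl) (auto simp: S23_def)
  moreover have "[a,a,a] \<otimes>\<^bsub>F2\<^esub> [a',a'] = [a]"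
    by (simp add: letter_inv_def)
  ultimately have "[a] \<in> generate F2 S23" by metis
  moreover have "[b] \<in> generate F2 S23"
    by (intro generate.incl) (auto simp: S23_def)
  ultimately have "(\<lambda>x. [(True, x)]) ` UNIV \<subseteq> generate F2 S23"
    by (auto, metis gen2.exhaust)
  then have "carrier F2 \<subseteq> generate F2 S23"
    using F2.generate_subgroup_incl[OF _ sub] generate_free_group[of UNIV]
    by (metis F2_def)
  then have "generate F2 S23 = carrier F2"
    using F2.generate_incl[OF S] by blast
  then show ?thesis
    using S by (auto simp: sym_generating_set_def S23_def inv_F2_S23)
qed

text \<open>The length of the integer \<open>p\<close> with respect to \<open>{\<plusminus>2, \<plusminus>3}\<close>.\<close>

definition len23 :: "int \<Rightarrow> nat" where
  "len23 p = (if \<bar>p\<bar> = 1 then 2 else nat ((\<bar>p\<bar> + 2) div 3))"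

text \<open>The argument \<open>p\<close> accumulates the exponent of the current power of \<open>a\<close>, so that
  \<open>lenF p w\<close> is the length of \<open>a\<^sup>p w\<close>.\<close>

fun lenF :: "int \<Rightarrow> gen2 word \<Rightarrow> nat" where
  "lenF p [] = len23 p"
| "lenF p ((e, Gen_a) # w) = lenF (if e then p + 1 else p - 1) w"
| "lenF p ((e, Gen_b) # w) = len23 p + 1 + lenF 0 w"

lemma len23_0 [simp]: "len23 0 = 0"
  by (simp add: len23_def)

lemma len23_eq_0:
  assumes "len23 p = 0"
  shows "p = 0"
proof -
  have "(\<bar>p\<bar> + 2) div 3 \<le> 0"
    using assms by (simp add: len23_def split: if_splits)
  then have "\<bar>p\<bar> + 2 < 3" by linarith
  then show ?thesis by linarith
qed

text \<open>Away from 1 and -1, \<open>len23\<close> is the ceiling of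
  \<open>\<bar>p\<bar> / 3\<close>, which a shift by at most 3 raises by at most 1. The exceptional
  value 2 is harmless, as 1 and -1 are not reached from 0 in one step.\<close>

lemma len23_Lipschitz:
  assumes "k \<in> {2, -2, 3, -3}"
  shows "len23 (p + k) \<le> len23 p + 1"
proof -
  have "2 \<le> \<bar>k\<bar>" "\<bar>k\<bar> \<le> 3" using assms by auto
  then have le: "\<bar>p + k\<bar> + 2 \<le> (\<bar>p\<bar> + 2) + 1 * 3" by linarith
  show ?thesis
  proof (cases "\<bar>p + k\<bar> = 1")
    case True
    then have "p \<noteq> 0" using \<open>2 \<le> \<bar>k\<bar>\<close> by auto
    then have "len23 p \<noteq> 0" using len23_eq_0 by blast
    then show ?thesis using True by (simp add: len23_def)
  next
    case False
    have "(\<bar>p + k\<bar> + 2) div 3 \<le> (\<bar>p\<bar> + 2) div 3 + 1"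
      using zdiv_mono1[OF le, of 3] by simp
    then have "len23 (p + k) \<le> nat ((\<bar>p\<bar> + 2) div 3) + 1"
      using False by (simp add: len23_def nat_le_iff pos_imp_zdiv_nonneg_iff)
    also have "nat ((\<bar>p\<bar> + 2) div 3) \<le> len23 p"
      by (simp add: len23_def)
    finally show ?thesis by simp
  qed
qed

text \<open>A step of 3 towards 0 lowers the ceiling by 1; only landing on the exceptional 1 must be
  avoided. Hence the separate cases up to 4, where 4 goes to 2 and 1 goes to -2.\<close>

lemma len23_descent:
  assumes "len23 p = Suc n"
  obtains k where "k \<in> {2, -2, 3, -3}" "len23 (p - k) = n"
proof -
  have minus: "len23 (- q) = len23 q" for q by (simp add: len23_def)
  have "\<exists>k\<in>{2, 3}. len23 (q - k) = n" if q: "q > 0" "len23 q = Suc n" for q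
  proof (cases "q \<le> 4")
    case True
    then have "q = 1 \<or> q = 2 \<or> q = 3 \<or> q = 4" using q(1) by linarith
    then show ?thesis using q(2) by (elim disjE) (simp_all add: len23_def)
  next
    case False
    then have "(q + 2) div 3 = (q - 3 + 2) div 3 + 1" by linarith
    then have "len23 (q - 3) = n" using q(2) False by (simp add: len23_def)
    then show ?thesis by simp
  qed
  from this[of p] this[of "- p"] have "\<exists>k\<in>{2, -2, 3, -3}. len23 (p - k) = n"
    using assms minus[of p] minus[of "p + 2"] minus[of "p + 3"]
    by (cases p "0 :: int" rule: linorder_cases) (auto simp: algebra_simps)
  with that show thesis by blast
qed

lemma lenF_Lipschitz: "k \<in> {2, -2, 3, -3} \<Longrightarrow> lenF (p + k) w \<le> lenF p w + 1"
proof (induction p w rule: lenF.induct)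
  case (2 p e w)
  then show ?case by (cases e) (simp_all add: algebra_simps)
qed (use len23_Lipschitz in auto)

text \<open>Equality holds even if the letter cancels, because the accumulator adds exponents. Left
  multiplication by a power of \<open>a\<close> thus only shifts \<open>p\<close>.\<close>

lemma lenF_cons_reduce_a:
  "lenF p (cons_reduce (e, Gen_a) w) = lenF (if e then p + 1 else p - 1) w"
  by (cases w) (auto simp: letter_inv_def)

lemma lenF_cons_reduce_b: "lenF 0 (cons_reduce (e, Gen_b) w) \<le> lenF 0 w + 1"
  by (cases w) (auto simp: letter_inv_def)

text \<open>A letter \<open>b\<close> or \<open>b'\<close> closes the current power of
  \<open>a\<close>, so lengths add up there, whether or not the word is reduced.\<close>

lemma lenF_append_b: "lenF p (u @ (e, Gen_b) # v) = lenF p u + 1 + lenF 0 v"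
  by (induction p u rule: lenF.induct) auto

section \<open>Words over \<open>S23\<close> that attain \<open>lenF\<close>\<close>

lemma ex_word_a_pow:
  "\<exists>ws. set ws \<subseteq> S23 \<and> length ws = len23 p \<and> foldr (\<otimes>\<^bsub>F2\<^esub>) ws [] = [a] [^]\<^bsub>F2\<^esub> p"
proof (induction "len23 p" arbitrary: p)
  case 0
  then show ?case using len23_eq_0[of p] by (intro exI[of _ "[]"]) (simp add: int_pow_0)
next
  case (Suc n)
  obtain k where k: "k \<in> {2, -2, 3, -3}" "len23 (p - k) = n"
    using len23_descent Suc(2) by metis
  obtain ws where ws: "set ws \<subseteq> S23" "length ws = n"
      "foldr (\<otimes>\<^bsub>F2\<^esub>) ws [] = [a] [^]\<^bsub>F2\<^esub> (p - k)"
    using Suc(1)[of "p - k"] k by auto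
  have pos: "[a] [^]\<^bsub>F2\<^esub> (2::int) = [a,a]" "[a] [^]\<^bsub>F2\<^esub> (3::int) = [a,a,a]"
    by (simp_all add: int_pow_def2 numeral_eq_Suc letter_inv_def)
  have neg: "[a] [^]\<^bsub>F2\<^esub> (- 2::int) = [a',a']" "[a] [^]\<^bsub>F2\<^esub> (- 3::int) = [a',a',a']"
    by (simp_all add: F2.int_pow_neg pos inv_F2_S23 del: mult_F2)
  have "[a] [^]\<^bsub>F2\<^esub> k \<in> S23"
    using k(1) pos neg by (auto simp: S23_def)
  moreover have "[a] [^]\<^bsub>F2\<^esub> k \<otimes>\<^bsub>F2\<^esub> [a] [^]\<^bsub>F2\<^esub> (p - k) = [a] [^]\<^bsub>F2\<^esub> p"
    using F2.int_pow_mult[of "[a]" k "p - k"] by simp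
  ultimately show ?case
    using ws Suc(2) by (intro exI[of _ "([a] [^]\<^bsub>F2\<^esub> k) # ws"]) simp
qed

text \<open>The power of \<open>a\<close> is carried along because \<open>lenF\<close> moves leading
  letters into the exponent; the case \<open>p = 0\<close> gives the upper bound on word
  length.\<close>

lemma ex_word_a_pow_mult:
  assumes "reduced w"
  shows "\<exists>ws. set ws \<subseteq> S23 \<and> length ws = lenF p w \<and>
           foldr (\<otimes>\<^bsub>F2\<^esub>) ws [] = [a] [^]\<^bsub>F2\<^esub> p \<otimes>\<^bsub>F2\<^esub> w"
  using assms
proof (induction p w rule: lenF.induct)
  case (1 p)
  have "[a] [^]\<^bsub>F2\<^esub> p \<otimes>\<^bsub>F2\<^esub> \<one>\<^bsub>F2\<^esub> = [a] [^]\<^bsub>F2\<^esub> p"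
    by (intro F2.r_one F2.int_pow_closed) simp
  then show ?case using ex_word_a_pow[of p] by simp
next
  case (2 p e w)
  let ?d = "if e then 1 else - 1 :: int"
  have w: "w \<in> carrier F2" using 2(2) reduced_ConsD by auto
  have pow: "[a] [^]\<^bsub>F2\<^esub> q \<in> carrier F2" for q :: int
    by (rule F2.int_pow_closed) simp
  have "inv\<^bsub>F2\<^esub> [a] = [a']"
    by (rule F2.inv_equality) (simp_all add: letter_inv_def)
  then have d: "[a] [^]\<^bsub>F2\<^esub> ?d = [(e, Gen_a)]"
    by (simp add: F2.int_pow_neg F2.int_pow_1 del: mult_F2)
  have "[(e, Gen_a)] \<otimes>\<^bsub>F2\<^esub> w = (e, Gen_a) # w"
    using 2(2) by (simp add: cons_reduce_reduced)
  then have "[a] [^]\<^bsub>F2\<^esub> p \<otimes>\<^bsub>F2\<^esub> ((e, Gen_a) # w) =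
      ([a] [^]\<^bsub>F2\<^esub> p \<otimes>\<^bsub>F2\<^esub> [a] [^]\<^bsub>F2\<^esub> ?d) \<otimes>\<^bsub>F2\<^esub> w"
    using F2.m_assoc[OF pow[of p] pow[of ?d] w] d by (simp del: mult_F2)
  also have "\<dots> = [a] [^]\<^bsub>F2\<^esub> (p + ?d) \<otimes>\<^bsub>F2\<^esub> w"
    using F2.int_pow_mult[of "[a]" p ?d] by (simp del: mult_F2)
  also have "p + ?d = (if e then p + 1 else p - 1)" by simp
  finally show ?case using 2(1) w by simp
next
  case (3 p e w)
  have w: "w \<in> carrier F2" using 3(2) reduced_ConsD by auto
  obtain us where us: "set us \<subseteq> S23" "length us = len23 p"
    "foldr (\<otimes>\<^bsub>F2\<^esub>) us \<one>\<^bsub>F2\<^esub> = [a] [^]\<^bsub>F2\<^esub> p"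
    using ex_word_a_pow[of p] by auto
  obtain vs where vs: "set vs \<subseteq> S23" "length vs = lenF 0 w"
    "foldr (\<otimes>\<^bsub>F2\<^esub>) vs \<one>\<^bsub>F2\<^esub> = w"
    using 3(1) w by (auto simp: int_pow_0)
  have s: "[(e, Gen_b)] \<in> S23" by (cases e) (auto simp: S23_def)
  have S: "S23 \<subseteq> carrier F2"
    using sym_generating_set_S23 by (simp add: sym_generating_set_def)
  have "foldr (\<otimes>\<^bsub>F2\<^esub>) (us @ [(e, Gen_b)] # vs) \<one>\<^bsub>F2\<^esub> =
      [a] [^]\<^bsub>F2\<^esub> p \<otimes>\<^bsub>F2\<^esub> foldr (\<otimes>\<^bsub>F2\<^esub>) ([(e, Gen_b)] # vs) \<one>\<^bsub>F2\<^esub>"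
    using F2.foldr_mult_append[of us "[(e, Gen_b)] # vs"] us vs s S by auto
  also have "foldr (\<otimes>\<^bsub>F2\<^esub>) ([(e, Gen_b)] # vs) \<one>\<^bsub>F2\<^esub> = (e, Gen_b) # w"
    using vs(3) 3(2) by (simp add: cons_reduce_reduced)
  finally show ?case
    using us vs s by (intro exI[of _ "us @ [(e, Gen_b)] # vs"]) auto
qed

lemma word_length_S23:
  assumes "reduced w"
  shows "word_length F2 S23 w = lenF 0 w"
proof -
  obtain ws where ws: "set ws \<subseteq> S23" "length ws = lenF 0 w" "foldr (\<otimes>\<^bsub>F2\<^esub>) ws \<one>\<^bsub>F2\<^esub> = w"
    using ex_word_a_pow_mult[OF assms, of 0] by (auto simp: int_pow_0)
  \<comment> \<open>This makes \<open>lenF 0\<close> a lower bound for word length, and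
    \<open>ws\<close> attains it.\<close>
  have "lenF 0 (s \<otimes>\<^bsub>F2\<^esub> g) \<le> Suc (lenF 0 g)" if "s \<in> S23" for s g
    using that lenF_Lipschitz[of _ 0 g] lenF_cons_reduce_b[of _ g]
    by (auto simp: S23_def lenF_cons_reduce_a)
  then show ?thesis
    using F2.word_length_eqI[of S23 "lenF 0" ws] ws sym_generating_set_S23
    by (auto simp: sym_generating_set_def)
qed

section \<open>Curvature of the two families\<close>

lemma reduced_Cons: "reduced (l # w) \<longleftrightarrow> reduced w \<and> (w \<noteq> [] \<longrightarrow> l \<noteq> letter_inv (hd w))"
  by (cases w) auto

lemma reduced_append:
  "reduced (u @ v) \<longleftrightarrow>
     reduced u \<and> reduced v \<and> (u \<noteq> [] \<longrightarrow> v \<noteq> [] \<longrightarrow> last u \<noteq> letter_inv (hd v))"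
  by (induction u) (auto simp: reduced_Cons hd_append)

lemma foldr_cons_reduce_eq_append:
  "reduced (u @ v) \<Longrightarrow> foldr cons_reduce u v = u @ v"
proof (induction u)
  case (Cons l u)
  then show ?case using reduced_ConsD[of l "u @ v"] cons_reduce_reduced[of l "u @ v"] by simp
qed simp

text \<open>The signs of the inner letters are chosen so that nothing cancels against \<open>h\<close>.\<close>

definition frame :: "gen2 \<Rightarrow> gen2 \<Rightarrow> gen2 word \<Rightarrow> gen2 word" where
  "frame y z h =
     [(True, y), (h = [] \<or> hd h \<noteq> (False, z), z)] @ h @
     [(h = [] \<or> last h \<noteq> (False, z), z), (True, y)]"

text \<open>Outer and inner letters belong to different generators, and an inner letter is negative
  only next to a negative \<open>z\<close>. For empty \<open>h\<close> the two inner letters meet,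
  both positive.\<close>

lemma reduced_frame: "y \<noteq> z \<Longrightarrow> reduced h \<Longrightarrow> reduced (frame y z h)"
  by (cases "h = []"; cases "hd h"; cases "last h")
     (auto simp: frame_def reduced_append reduced_Cons letter_inv_def hd_append)

text \<open>Whatever the signs, exactly two letters are added at each end, so deleting them recovers
  \<open>h\<close>.\<close>

lemma inj_frame: "inj (frame y z)"
  by (rule injI) (simp add: frame_def)

text \<open>Each end has length 3: 2 for its power of \<open>a\<close> and 1 for its power of
  \<open>b\<close>. Subadditivity suffices, which covers the case that inner powers of
  \<open>a\<close> merge with those of \<open>h\<close>.\<close>

lemma word_length_frame_le:
  assumes "y \<noteq> z" "reduced h"
  shows "word_length F2 S23 (frame y z h) \<le> word_length F2 S23 h + 6"
proof -
  have red: "reduced (frame y z h)" using assms by (rule reduced_frame)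
  obtain e f where fr: "frame y z h = [(True, y), (e, z)] @ h @ [(f, z), (True, y)]"
    by (simp add: frame_def)
  have 1: "word_length F2 S23 [(True, y), (e, z)] = 3" "word_length F2 S23 [(f, z), (True, y)] = 3"
    using assms(1) by (cases y; cases z; simp add: word_length_S23 letter_inv_def len23_def)+
  have "frame y z h = [(True, y), (e, z)] \<otimes>\<^bsub>F2\<^esub> (h \<otimes>\<^bsub>F2\<^esub> [(f, z), (True, y)])"
    using red unfolding fr mult_F2
    by (metis foldr_cons_reduce_eq_append reduced_append)
  moreover have "word_length F2 S23 (u \<otimes>\<^bsub>F2\<^esub> v) \<le> word_length F2 S23 u + word_length F2 S23 v"
    if "reduced u" "reduced v" for u v
    using F2.word_length_mult_le[OF sym_generating_set_S23, of u v] that by simp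
  moreover have "reduced [(True, y), (e, z)]" "reduced [(f, z), (True, y)]"
    using assms(1) by (auto simp: letter_inv_def)
  ultimately show ?thesis
    using 1 assms(2) by (smt (verit) mult_F2 reduced_foldr add.commute add_le_cancel_left le_trans numeral_Bit0 add.assoc)
qed

text \<open>In \<open>s^-1 (g s)\<close> a left factor that is a power of \<open>a\<close> goes into
  the argument of \<open>lenF\<close>, so only the product on the right is left to reduce.\<close>

lemma gen_con_S23:
  assumes "reduced g"
  shows "gen_con F2 S23 g = real
    (lenF (- 2) (foldr cons_reduce g [a,a]) + lenF 2 (foldr cons_reduce g [a',a']) +
     lenF (- 3) (foldr cons_reduce g [a,a,a]) + lenF 3 (foldr cons_reduce g [a',a',a']) +
     lenF 0 (cons_reduce b' (foldr cons_reduce g [b])) +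
     lenF 0 (cons_reduce b (foldr cons_reduce g [b']))) / 6"
proof -
  have "word_length F2 S23 (inv\<^bsub>F2\<^esub> s \<otimes>\<^bsub>F2\<^esub> g \<otimes>\<^bsub>F2\<^esub> s) =
      lenF 0 (inv\<^bsub>F2\<^esub> s \<otimes>\<^bsub>F2\<^esub> (g \<otimes>\<^bsub>F2\<^esub> s))" if "s \<in> S23" for s
  proof -
    have s: "s \<in> carrier F2" using that sym_generating_set_S23
      by (auto simp: sym_generating_set_def)
    then have "inv\<^bsub>F2\<^esub> s \<in> carrier F2" by (rule F2.inv_closed)
    then show ?thesis
      using s assms F2.m_assoc[of "inv\<^bsub>F2\<^esub> s" g s]
      by (simp add: word_length_S23 reduced_foldr)
  qed
  then have "gen_con F2 S23 g =
      1 / real (card S23) * (\<Sum>s\<in>S23. real (lenF 0 (inv\<^bsub>F2\<^esub> s \<otimes>\<^bsub>F2\<^esub> (g \<otimes>\<^bsub>F2\<^esub> s))))"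
    unfolding gen_con_def by simp
  then show ?thesis
    by (simp add: S23_def inv_F2_S23 lenF_cons_reduce_a)
qed

lemma curvature_frame_zero:
  assumes "reduced h"
  shows "curvature F2 S23 (frame Gen_a Gen_b h) = 0"
proof -
  obtain e f where fr: "frame Gen_a Gen_b h = a # ((e, Gen_b) # h @ [(f, Gen_b)]) @ [a]"
    by (simp add: frame_def)
  define u where "u = (e, Gen_b) # h @ [(f, Gen_b)]"
  have fr: "frame Gen_a Gen_b h = a # u @ [a]"
    using fr by (simp add: u_def)
  have red: "reduced (a # u @ [a])"
    using reduced_frame[of Gen_a Gen_b h] assms fr by simp
  have "reduced u"
    using red reduced_ConsD reduced_append[of u "[a]"] by blast
  moreover have "last u = (f, Gen_b)" by (simp add: u_def)
  ultimately have app: "foldr cons_reduce u t = u @ t"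
    if "reduced t" "t \<noteq> [] \<longrightarrow> snd (hd t) = Gen_a" for t
    using that by (intro foldr_cons_reduce_eq_append) (auto simp: reduced_append letter_inv_def)
  have lenF_u: "lenF p (u @ t) = len23 p + lenF 0 h + lenF 0 t + 2" for p t
    by (simp add: u_def lenF_append_b)
  have len: "lenF p (foldr cons_reduce (a # u @ [a]) s) =
      len23 (p + 1) + lenF 0 h + lenF 0 (cons_reduce a s) + 2"
    if "reduced (cons_reduce a s)" "cons_reduce a s \<noteq> [] \<longrightarrow> snd (hd (cons_reduce a s)) = Gen_a" for p s
    using app[OF that] by (simp add: lenF_cons_reduce_a lenF_u)
  \<comment> \<open>Nothing cancels against the outer \<open>a\<close>, so both ends gain a letter:
    2 more than the length \<open>lenF 0 h + 6\<close>.\<close>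
  have len_b: "lenF 0 (cons_reduce (k, Gen_b) (foldr cons_reduce (a # u @ [a]) [(l, Gen_b)])) = lenF 0 h + 8"
    for k l
  proof -
    have "foldr cons_reduce u [a, (l, Gen_b)] = u @ [a, (l, Gen_b)]"
      by (intro app) (simp_all add: letter_inv_def)
    moreover have "cons_reduce a (u @ t) = a # u @ t" for t
      by (simp add: u_def letter_inv_def)
    ultimately show ?thesis
      by (simp add: letter_inv_def lenF_u len23_def)
  qed
  have "lenF 0 (a # u @ [a]) = lenF 0 h + 6"
    by (simp add: lenF_u len23_def)
  then have "word_length F2 S23 (a # u @ [a]) = lenF 0 h + 6"
    using red by (simp add: word_length_S23)
  \<comment> \<open>Over the four powers of \<open>a\<close>, the exponent 1 at either end becomes
    -1, 3, -2, 4, of total length 6. These conjugates contribute \<open>4 * lenF 0 h + 20\<close>,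
    the other two \<open>2 * (lenF 0 h + 8)\<close>: six times the word length.\<close>
  moreover have "gen_con F2 S23 (a # u @ [a]) = real (lenF 0 h + 6)"
    unfolding gen_con_S23[OF red] len_b
    by (subst len, simp add: letter_inv_def, simp add: letter_inv_def)+
       (simp add: letter_inv_def len23_def)
  ultimately show ?thesis
    by (simp add: curvature_def fr)
qed

lemma curvature_frame_neg:
  assumes "reduced h"
  shows "curvature F2 S23 (frame Gen_b Gen_a h) < 0"
proof -
  obtain e f where fr: "frame Gen_b Gen_a h = b # ((e, Gen_a) # h @ [(f, Gen_a)]) @ [b]"
    by (simp add: frame_def)
  define u where "u = (e, Gen_a) # h @ [(f, Gen_a)]"
  have fr: "frame Gen_b Gen_a h = b # u @ [b]"
    using fr by (simp add: u_def)
  have red: "reduced (b # u @ [b])"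
    using reduced_frame[of Gen_b Gen_a h] assms fr by simp
  have "reduced u"
    using red reduced_ConsD reduced_append[of u "[b]"] by blast
  moreover have "last u = (f, Gen_a)" by (simp add: u_def)
  ultimately have app: "foldr cons_reduce u t = u @ t"
    if "reduced t" "t \<noteq> [] \<longrightarrow> snd (hd t) = Gen_b" for t
    using that by (intro foldr_cons_reduce_eq_append) (auto simp: reduced_append letter_inv_def)
  have cons_u: "cons_reduce (k, Gen_b) (u @ t) = (k, Gen_b) # u @ t" for k t
    by (simp add: u_def letter_inv_def)
  \<comment> \<open>The ends of \<open>u\<close> may merge with powers of \<open>a\<close> in
    \<open>h\<close>, so \<open>lenF 0 u\<close> is kept as a single quantity.\<close>
  have [simp]: "lenF 0 (u @ (k, Gen_b) # t) = lenF 0 u + lenF 0 t + 1" for k t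
    by (simp add: lenF_append_b)
  have fold: "foldr cons_reduce (b # u @ [b]) s = b # u @ cons_reduce b s"
    if "reduced (cons_reduce b s)" "cons_reduce b s \<noteq> [] \<longrightarrow> snd (hd (cons_reduce b s)) = Gen_b" for s
    using app[OF that] cons_u by simp
  have "word_length F2 S23 (b # u @ [b]) = lenF 0 u + 2"
    using red by (simp add: word_length_S23)
  \<comment> \<open>The excess is 8 = 4 * 2: each of the four powers of \<open>a\<close> adds length
    1 at both ends. Conjugation by \<open>b\<close> or \<open>b'\<close> only moves a letter
    \<open>b\<close> from one end to the other.\<close>
  moreover have "gen_con F2 S23 (b # u @ [b]) = real (6 * (lenF 0 u + 2) + 8) / 6"
    unfolding gen_con_S23[OF red]
    by (subst fold, simp add: letter_inv_def, simp add: letter_inv_def)+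
       (simp add: letter_inv_def len23_def cons_u)
  ultimately show ?thesis
    by (simp add: curvature_def fr field_simps)
qed

theorem theorem1:
  "\<exists>S. sym_generating_set F2 S \<and>
       curvature_positive_density F2 S (\<lambda>k. k = 0) \<and>
       curvature_positive_density F2 S (\<lambda>k. k < 0)"
proof (intro exI[of _ S23] conjI)
  have "frame y z h \<in> carrier F2 - {\<one>\<^bsub>F2\<^esub>}" if "y \<noteq> z" "reduced h" for y z h
    using reduced_frame[OF that] by (auto simp: frame_def)
  note * = this word_length_frame_le inj_frame[THEN inj_on_subset]
  show "curvature_positive_density F2 S23 (\<lambda>k. k = 0)"
    by (rule F2.curvature_positive_densityI[of _ "frame Gen_a Gen_b" _ 6])
       (use sym_generating_set_S23 * curvature_frame_zero in auto)
  show "curvature_positive_density F2 S23 (\<lambda>k. k < 0)"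
    by (rule F2.curvature_positive_densityI[of _ "frame Gen_b Gen_a" _ 6])
       (use sym_generating_set_S23 * curvature_frame_neg in auto)
qed (rule sym_generating_set_S23)

end
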